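(* Let $E$ be a finite set, $p \in (0,1)$, and $k \ge 1$ an integer. Every $k$-intersection system $\mathcal{D} \subseteq 2^E$ admits a $(p, pk)$-uniform exchange map.
   Context: A $k$-intersection system is a family $\mathcal{D} = \mathcal{I}_1 \cap \dots \cap \mathcal{I}_k$, where $\mathcal{I}_1, \dots, \mathcal{I}_k$ are the independent set families of $k$ matroids on the ground set $E$. Exchange maps: for $X, Y \in \mathcal{D}$, an exchange map between $X$ and $Y$ is a pair of (possibly random, with internal randomness independent of the argument) functions $S_{X,Y} \colon 2^{Y \setminus X} \to 2^{Y \setminus X}$ and $T_{X,Y} \colon 2^{Y \setminus X} \to 2^{X \setminus Y}$ such that for every $R \subseteq Y \setminus X$: (1) $S_{X,Y}(R) \subseteq R$, and (2) $(X \cup S_{X,Y}(R)) \setminus T_{X,Y}(R) \in \mathcal{D}$. It is $(\alpha,\beta)$-uniform if $\Pr(y \in S_{X,Y}(R)) \ge \alpha$ for all $y \in Y \setminus X$ and $\Pr(x \in T_{X,Y}(R)) \le \beta$ for all $x \in X \setminus Y$, where the probability is over the random set $R \subseteq Y \setminus X$ containing each $y \in Y\setminus X$ independently with probability $p$ (and the internal randomness). $\mathcal{D}$ admits an $(\alpha,\beta)$-uniform exchange map if there is an $(\alpha,\beta)$-uniform exchange map between $X$ and $Y$ for all $X, Y \in \mathcal{D}$. *)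

theory Defs
  imports "HOL-Probability.Probability"
begin

locale matroid =
  fixes E :: "'a set" and \<I> :: "'a set set"
  assumes finite_ground: "finite E"
    and indep_subset_ground: "A \<in> \<I> \<Longrightarrow> A \<subseteq> E"
    and indep_empty: "{} \<in> \<I>"
    and indep_mono: "B \<in> \<I> \<Longrightarrow> A \<subseteq> B \<Longrightarrow> A \<in> \<I>"
    and augmentation:
      "A \<in> \<I> \<Longrightarrow> B \<in> \<I> \<Longrightarrow> card A < card B \<Longrightarrow> \<exists>b\<in>B - A. insert b A \<in> \<I>"

text \<open>The matroids need not be distinct. For \<open>k = 0\<close> the intersection would be \<open>UNIV\<close>;
  the notion is only meant for \<open>k \<ge> 1\<close>.\<close>

definition k_intersection_system :: "nat \<Rightarrow> 'a set \<Rightarrow> 'a set set \<Rightarrow> bool" where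
  "k_intersection_system k E D \<longleftrightarrow>
     (\<exists>\<I> :: nat \<Rightarrow> 'a set set. (\<forall>i\<in>{1..k}. matroid E (\<I> i)) \<and> D = (\<Inter>i\<in>{1..k}. \<I> i))"

definition random_subset :: "'a set \<Rightarrow> real \<Rightarrow> 'a set pmf" where
  "random_subset A p = map_pmf (\<lambda>f. {a \<in> A. f a}) (Pi_pmf A False (\<lambda>_. bernoulli_pmf p))"

text \<open>One realisation \<open>(S, T)\<close> of an exchange map between \<open>X\<close> and \<open>Y\<close>. Values of \<open>S\<close> and \<open>T\<close>
  at arguments that are not subsets of \<open>Y - X\<close> are irrelevant.\<close>

definition exchange_pair ::
  "'a set set \<Rightarrow> 'a set \<Rightarrow> 'a set \<Rightarrow> ('a set \<Rightarrow> 'a set) \<times> ('a set \<Rightarrow> 'a set) \<Rightarrow> bool" where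
  "exchange_pair D X Y = (\<lambda>(S, T). \<forall>R. R \<subseteq> Y - X \<longrightarrow>
     S R \<subseteq> R \<and> T R \<subseteq> X - Y \<and> (X \<union> S R) - T R \<in> D)"

text \<open>A possibly random exchange map is a distribution on pairs of functions, all of whose
  outcomes are exchange pairs; a deterministic one is a point mass. The pair is drawn without
  knowledge of the argument \<open>R\<close>, which is why \<open>R\<close> enters below through a product distribution.
  Since \<open>X\<close> and \<open>Y\<close> are finite, only finitely many functions on the relevant
  arguments exist, so discrete distributions lose no generality.\<close>

definition exchange_map ::
  "'a set set \<Rightarrow> 'a set \<Rightarrow> 'a set \<Rightarrow> (('a set \<Rightarrow> 'a set) \<times> ('a set \<Rightarrow> 'a set)) pmf \<Rightarrow> bool" where
  "exchange_map D X Y M \<longleftrightarrow> (\<forall>ST\<in>set_pmf M. exchange_pair D X Y ST)"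

definition uniform_exchange_map ::
  "real \<Rightarrow> real \<Rightarrow> real \<Rightarrow> 'a set set \<Rightarrow> 'a set \<Rightarrow> 'a set
     \<Rightarrow> (('a set \<Rightarrow> 'a set) \<times> ('a set \<Rightarrow> 'a set)) pmf \<Rightarrow> bool" where
  "uniform_exchange_map p \<alpha> \<beta> D X Y M \<longleftrightarrow>
     exchange_map D X Y M \<and>
     (\<forall>y\<in>Y - X. measure_pmf.prob (pair_pmf M (random_subset (Y - X) p))
                   {((S, T), R). y \<in> S R} \<ge> \<alpha>) \<and>
     (\<forall>x\<in>X - Y. measure_pmf.prob (pair_pmf M (random_subset (Y - X) p))
                   {((S, T), R). x \<in> T R} \<le> \<beta>)"

definition admits_uniform_exchange_map :: "real \<Rightarrow> real \<Rightarrow> real \<Rightarrow> 'a set set \<Rightarrow> bool" where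
  "admits_uniform_exchange_map p \<alpha> \<beta> D \<longleftrightarrow>
     (\<forall>X\<in>D. \<forall>Y\<in>D. \<exists>M. uniform_exchange_map p \<alpha> \<beta> D X Y M)"

end

theory Submission
  imports Defs
begin

text \<open>Take \<open>S = id\<close>. By minimax duality it suffices to find, for every nonnegative weight \<open>w\<close> on \<open>X - Y\<close>,
  a deterministic \<open>T\<close> whose expected weight is at most \<open>p * k * w (X - Y)\<close>, and taking unions reduces
  this to a single matroid. There \<open>T R\<close> is the complement of the greedy completion of
  \<open>(X \<inter> Y) \<union> R\<close> in order of decreasing weight. The bound follows by Abel summation from the case where
  \<open>w\<close> is the indicator of a prefix of that order, which follows from the
  lower bound \<open>(1 - p) * f {} + p * f V\<close> on the expectation of \<open>f R\<close> for submodular \<open>f\<close>, where \<open>V = Y - X\<close>.\<close>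

section \<open>A minimax theorem\<close>

text \<open>Existence by compactness: \<open>K\<close> is a closed slice of a product of compact
  sets, and the objective depends continuously on the coordinates in \<open>J\<close>. Forcing
  \<open>l\<close> to vanish off \<open>J\<close> is what makes \<open>K\<close> compact in the
  space of all functions.\<close>

lemma nonneg_combination_minimum:
  fixes v :: "'j \<Rightarrow> 'i \<Rightarrow> real" and I :: "'i set"
  assumes "finite J" "J \<noteq> {}"
  defines "K \<equiv> {l. (\<forall>j\<in>J. 0 \<le> l j) \<and> (\<forall>j. j \<notin> J \<longrightarrow> l j = 0) \<and> sum l J = 1}"
  defines "\<Phi> \<equiv> \<lambda>l. \<Sum>i\<in>I. (max 0 (\<Sum>j\<in>J. l j * v j i))\<^sup>2"
  shows "\<exists>l\<in>K. \<forall>l'\<in>K. \<Phi> l \<le> \<Phi> l'"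
proof -
  let ?P = "PiE UNIV (\<lambda>j. if j \<in> J then {0..1} else {0::real})"
  have "compactin (product_topology (\<lambda>i. euclidean) UNIV) ?P"
    by (subst compactin_PiE) auto
  then have "compact ?P"
    by (simp add: euclidean_product_topology)
  moreover have cont: "continuous_on UNIV (\<lambda>l::'j \<Rightarrow> real. l j)" for j
    by simp
  have "closed {l::'j \<Rightarrow> real. sum l J = 1}"
    by (intro closed_Collect_eq continuous_on_sum cont continuous_on_const)
  ultimately have "compact (?P \<inter> {l. sum l J = 1})"
    by (rule compact_Int_closed)
  also have "?P \<inter> {l. sum l J = 1} = K"
  proof -
    have "l j \<le> 1" if "\<forall>j\<in>J. 0 \<le> l j" "sum l J = 1" "j \<in> J" for l :: "'j \<Rightarrow> real" and j
      using member_le_sum[of j J l] that \<open>finite J\<close> by auto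
    then show ?thesis
      by (auto simp: K_def PiE_iff split: if_splits)
  qed
  finally have "compact K" .
  moreover have "K \<noteq> {}"
  proof -
    obtain j where "j \<in> J" using \<open>J \<noteq> {}\<close> by blast
    then have "(\<lambda>i. if i = j then 1 else 0) \<in> K"
      using \<open>finite J\<close> by (auto simp: K_def)
    then show ?thesis by blast
  qed
  moreover have "continuous_on K \<Phi>"
    unfolding \<Phi>_def
    by (intro continuous_intros continuous_on_subset[OF cont]) auto
  ultimately show ?thesis
    by (rule continuous_attains_inf)
qed

text \<open>At a minimiser of \<open>\<Phi> u = (\<Sum>i. (max 0 (u i))\<^sup>2)\<close> over the convex hull, moving towards the point that
  the hypothesis supplies for the weights \<open>max 0 (u i)\<close> would decrease \<open>\<Phi>\<close> unless \<open>\<Phi> u = 0\<close>.\<close>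

lemma ville_minimax:
  fixes v :: "'j \<Rightarrow> 'i \<Rightarrow> real"
  assumes "finite J" "finite I"
    and weights: "\<And>w. (\<And>i. i \<in> I \<Longrightarrow> 0 \<le> w i) \<Longrightarrow> \<exists>j\<in>J. (\<Sum>i\<in>I. w i * v j i) \<le> 0"
  obtains l where "\<And>j. 0 \<le> l j" "\<And>j. j \<notin> J \<Longrightarrow> l j = 0" "sum l J = 1"
    "\<And>i. i \<in> I \<Longrightarrow> (\<Sum>j\<in>J. l j * v j i) \<le> 0"
proof -
  define K where "K = {l. (\<forall>j\<in>J. 0 \<le> l j) \<and> (\<forall>j. j \<notin> J \<longrightarrow> l j = 0) \<and> sum l J = (1::real)}"
  define \<Phi> where "\<Phi> = (\<lambda>l. \<Sum>i\<in>I. (max 0 (\<Sum>j\<in>J. l j * v j i))\<^sup>2)"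
  have "J \<noteq> {}" using weights[of "\<lambda>_. 0"] by auto
  then have "\<exists>l\<in>K. \<forall>l'\<in>K. \<Phi> l \<le> \<Phi> l'"
    unfolding K_def \<Phi>_def by (intro nonneg_combination_minimum assms(1))
  then obtain l where l: "l \<in> K" and min: "\<And>l'. l' \<in> K \<Longrightarrow> \<Phi> l \<le> \<Phi> l'"
    by blast
  define u where "u = (\<lambda>i. \<Sum>j\<in>J. l j * v j i)"
  define w where "w = (\<lambda>i. max 0 (u i))"
  obtain k where k: "k \<in> J" "(\<Sum>i\<in>I. w i * v k i) \<le> 0"
    using weights[of w] by (auto simp: w_def)
  \<comment> \<open>The squared distance from \<open>u\<close> to the point \<open>v k\<close>: the
    second-order cost of moving from \<open>u\<close> towards it.\<close>
  define B where "B = (\<Sum>i\<in>I. (v k i - u i)\<^sup>2)"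
  have "B \<ge> 0" by (simp add: B_def sum_nonneg)
  have \<Phi>l: "\<Phi> l = (\<Sum>i\<in>I. (w i)\<^sup>2)"
    by (simp add: \<Phi>_def w_def u_def)
  have "\<Phi> l \<ge> 0" by (simp add: \<Phi>l sum_nonneg)
  have step: "\<Phi> l \<le> \<Phi> l - 2 * g * \<Phi> l + g\<^sup>2 * B" if g: "0 \<le> g" "g \<le> 1" for g
  proof -
    define l' where "l' = (\<lambda>j. (1 - g) * l j + (if j = k then g else 0))"
    have "l' \<in> K"
      using l k(1) g \<open>finite J\<close>
      by (auto simp: K_def l'_def sum.distrib simp flip: sum_distrib_left)
    have u': "(\<Sum>j\<in>J. l' j * v j i) = u i + g * (v k i - u i)" for i
    proof -
      have "(\<Sum>j\<in>J. l' j * v j i)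
          = (\<Sum>j\<in>J. (1 - g) * (l j * v j i) + (if j = k then g * v k i else 0))"
        by (intro sum.cong) (auto simp: l'_def algebra_simps)
      also have "\<dots> = (1 - g) * u i + g * v k i"
        using k(1) \<open>finite J\<close> by (simp add: sum.distrib u_def flip: sum_distrib_left)
      finally show ?thesis by (simp add: algebra_simps)
    qed
    \<comment> \<open>Replacing \<open>u i\<close> by \<open>w i\<close> inside the square can only
      enlarge it and leaves a polynomial in \<open>g\<close>, whose cross term simplifies through
      \<open>w i * u i = (w i)\<^sup>2\<close>.\<close>
    have "(max 0 (u i + g * (v k i - u i)))\<^sup>2
        \<le> (w i)\<^sup>2 + 2 * g * (w i * v k i) - 2 * g * (w i)\<^sup>2 + g\<^sup>2 * (v k i - u i)\<^sup>2" for i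
    proof -
      have "(max 0 (u i + g * (v k i - u i)))\<^sup>2 \<le> (w i + g * (v k i - u i))\<^sup>2"
        by (rule abs_le_square_iff[THEN iffD1]) (auto simp: w_def)
      also have "\<dots> = (w i)\<^sup>2 + 2 * g * (w i * v k i) - 2 * g * (w i * u i)
          + g\<^sup>2 * (v k i - u i)\<^sup>2"
        by (simp add: power2_eq_square algebra_simps)
      also have "w i * u i = (w i)\<^sup>2"
        by (auto simp: w_def max_def power2_eq_square)
      finally show ?thesis .
    qed
    then have "\<Phi> l' \<le> (\<Sum>i\<in>I. (w i)\<^sup>2 + 2 * g * (w i * v k i) - 2 * g * (w i)\<^sup>2
        + g\<^sup>2 * (v k i - u i)\<^sup>2)"
      unfolding \<Phi>_def u' by (intro sum_mono)
    also have "\<dots> = \<Phi> l + 2 * g * (\<Sum>i\<in>I. w i * v k i) - 2 * g * \<Phi> l + g\<^sup>2 * B"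
      by (simp add: \<Phi>l B_def sum.distrib sum_subtractf sum_distrib_left)
    also have "\<dots> \<le> \<Phi> l - 2 * g * \<Phi> l + g\<^sup>2 * B"
      using mult_nonneg_nonpos[of "2 * g", OF _ k(2)] g by simp
    finally show ?thesis
      using min[of l'] \<open>l' \<in> K\<close> by linarith
  qed
  have "\<Phi> l = 0"
  proof (rule ccontr)
    assume "\<Phi> l \<noteq> 0"
    with \<open>\<Phi> l \<ge> 0\<close> have pos: "\<Phi> l > 0" by simp
    \<comment> \<open>The quadratic in \<open>step\<close> is smallest at
      \<open>\<Phi> l / B\<close>. Adding \<open>\<Phi> l\<close> to the denominator keeps
      \<open>g\<close> at most 1, covers \<open>B = 0\<close>, and still yields
      \<open>2 * \<Phi> l \<le> \<Phi> l\<close>.\<close>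
    define g where "g = \<Phi> l / (\<Phi> l + B)"
    have g: "0 < g" "g \<le> 1" "g * (\<Phi> l + B) = \<Phi> l"
      using pos \<open>B \<ge> 0\<close> by (auto simp: g_def)
    have "2 * g * \<Phi> l \<le> g * (g * B)"
      using step[of g] g by (simp add: power2_eq_square)
    then have "2 * \<Phi> l \<le> g * B" using g(1) by simp
    also have "\<dots> \<le> g * (\<Phi> l + B)" using pos g(1) by (simp add: algebra_simps)
    finally show False using pos g(3) by simp
  qed
  then have "u i \<le> 0" if "i \<in> I" for i
    using that \<open>finite I\<close> by (auto simp: \<Phi>l sum_nonneg_eq_0_iff w_def max_def split: if_splits)
  then show thesis
    using that[of l] l unfolding K_def u_def by fastforce
qed

lemma ville_minimax_pmf:
  fixes v :: "'j \<Rightarrow> 'i \<Rightarrow> real"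
  assumes "finite J" "finite I"
    and "\<And>w. (\<And>i. i \<in> I \<Longrightarrow> 0 \<le> w i) \<Longrightarrow> \<exists>j\<in>J. (\<Sum>i\<in>I. w i * v j i) \<le> 0"
  obtains M where "set_pmf M \<subseteq> J" "\<And>i. i \<in> I \<Longrightarrow> (\<Sum>j\<in>J. pmf M j * v j i) \<le> 0"
proof -
  obtain l where l: "\<And>j. 0 \<le> l j" "\<And>j. j \<notin> J \<Longrightarrow> l j = 0" "sum l J = 1"
    "\<And>i. i \<in> I \<Longrightarrow> (\<Sum>j\<in>J. l j * v j i) \<le> 0"
    using ville_minimax[where v = v, OF assms] by blast
  have "(\<integral>\<^sup>+j. ennreal (l j) \<partial>count_space UNIV) = (\<Sum>j\<in>J. ennreal (l j))"
    by (rule nn_integral_count_space') (use assms(1) l in auto)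
  also have "\<dots> = 1"
    using l by (simp add: sum_ennreal)
  finally have 1: "(\<integral>\<^sup>+j. ennreal (l j) \<partial>count_space UNIV) = 1" .
  show thesis
  proof (rule that)
    show "set_pmf (embed_pmf l) \<subseteq> J"
      using l(2) set_embed_pmf[OF l(1) 1] by auto
    show "(\<Sum>j\<in>J. pmf (embed_pmf l) j * v j i) \<le> 0" if "i \<in> I" for i
      using l(4)[OF that] by (simp add: pmf_embed_pmf[OF l(1) 1])
  qed
qed

section \<open>Random subsets\<close>

lemma finite_set_random_subset:
  assumes "finite V"
  shows "finite (set_pmf (random_subset V p))"
  by (rule finite_subset[of _ "Pow V"]) (use assms in \<open>auto simp: random_subset_def\<close>)

lemma set_random_subset: "set_pmf (random_subset V p) \<subseteq> Pow V"
  by (auto simp: random_subset_def)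

lemma prob_random_subset_member:
  assumes "finite V" "y \<in> V" "0 \<le> p" "p \<le> 1"
  shows "measure_pmf.prob (random_subset V p) {R. y \<in> R} = p"
proof -
  have "measure_pmf.prob (random_subset V p) {R. y \<in> R}
      = measure_pmf.prob (map_pmf (\<lambda>f. f y) (Pi_pmf V False (\<lambda>_. bernoulli_pmf p))) {True}"
    unfolding random_subset_def measure_map_pmf
    using assms by (intro arg_cong2[where f = measure_pmf.prob] refl) auto
  also have "\<dots> = p"
    using assms by (simp add: Pi_pmf_component measure_pmf_single)
  finally show ?thesis .
qed

lemma random_subset_empty: "random_subset {} p = return_pmf {}"
  by (simp add: random_subset_def map_pmf_const)

text \<open>Isolates the coin of one element, which prepares induction on the ground set.\<close>

lemma random_subset_insert:
  assumes "finite V" "y \<notin> V"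
  shows "random_subset (insert y V) p =
    bernoulli_pmf p \<bind> (\<lambda>b. map_pmf (\<lambda>R. if b then insert y R else R) (random_subset V p))"
proof -
  have "{a. (a = y \<or> a \<in> V) \<and> (a \<noteq> y \<longrightarrow> f a) \<and> (a = y \<longrightarrow> b)}
      = (if b then insert y {a \<in> V. f a} else {a \<in> V. f a})" for f b
    using assms(2) by auto
  then show ?thesis
    using assms
    by (simp add: random_subset_def Pi_pmf_insert' map_bind_pmf map_pmf_comp map_pmf_def[symmetric]
        if_distrib cong: if_cong)
      (auto simp: map_pmf_def bind_assoc_pmf bind_return_pmf intro!: bind_pmf_cong)
qed

lemma expectation_random_subset_insert:
  fixes f :: "'a set \<Rightarrow> real"
  assumes "finite V" "y \<notin> V" "0 \<le> p" "p \<le> 1"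
  shows "measure_pmf.expectation (random_subset (insert y V) p) f =
    (1 - p) * measure_pmf.expectation (random_subset V p) f +
    p * measure_pmf.expectation (random_subset V p) (\<lambda>R. f (insert y R))"
  unfolding random_subset_insert[OF assms(1,2)]
  by (subst pmf_expectation_bind[where A = UNIV])
    (use assms in \<open>auto simp: finite_set_random_subset UNIV_bool\<close>)

text \<open>Compares the Lovasz extension of \<open>f\<close> at the constant vector
  \<open>p\<close> with its multilinear extension. Split on whether \<open>y\<close> is sampled:
  both conditional functions are again submodular on \<open>V\<close>, so the induction hypothesis
  bounds each of them.\<close>

lemma submodular_expectation_ge:
  fixes f :: "'a set \<Rightarrow> real"
  assumes "finite V" "0 \<le> p" "p \<le> 1"
    and "\<And>A B. A \<subseteq> V \<Longrightarrow> B \<subseteq> V \<Longrightarrow> f (A \<union> B) + f (A \<inter> B) \<le> f A + f B"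
  shows "(1 - p) * f {} + p * f V \<le> measure_pmf.expectation (random_subset V p) f"
  using assms(1,4)
proof (induction V arbitrary: f rule: finite_induct)
  case empty
  then show ?case by (simp add: random_subset_empty algebra_simps)
next
  case (insert y V)
  have 1: "(1 - p) * f {} + p * f V \<le> measure_pmf.expectation (random_subset V p) f"
    by (rule insert.IH) (use insert.prems in blast)
  have 2: "(1 - p) * f {y} + p * f (insert y V)
      \<le> measure_pmf.expectation (random_subset V p) (\<lambda>R. f (insert y R))"
  proof (rule insert.IH)
    fix A B assume "A \<subseteq> V" "B \<subseteq> V"
    then show "f (insert y (A \<union> B)) + f (insert y (A \<inter> B)) \<le> f (insert y A) + f (insert y B)"
      using insert.prems[of "insert y A" "insert y B"] by auto
  qed
  \<comment> \<open>In the combined bounds \<open>f {y}\<close> and \<open>f V\<close> both carry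
    the weight \<open>p * (1 - p)\<close>. Trading them for \<open>f {}\<close> and
    \<open>f (insert y V)\<close> completes the weights \<open>(1 - p)\<^sup>2\<close> and
    \<open>p\<^sup>2\<close> of those two to \<open>1 - p\<close> and \<open>p\<close>.\<close>
  have "f (insert y V) + f {} \<le> f {y} + f V"
    using insert.prems[of "{y}" V] insert.hyps by auto
  then have "p * (1 - p) * (f (insert y V) + f {}) \<le> p * (1 - p) * (f {y} + f V)"
    using assms(2,3) by (intro mult_left_mono) auto
  then have "(1 - p) * f {} + p * f (insert y V)
      \<le> (1 - p) * ((1 - p) * f {} + p * f V) + p * ((1 - p) * f {y} + p * f (insert y V))"
    by (simp add: algebra_simps)
  also have "\<dots> \<le> (1 - p) * measure_pmf.expectation (random_subset V p) f
      + p * measure_pmf.expectation (random_subset V p) (\<lambda>R. f (insert y R))"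
    using 1 2 assms(2,3) by (intro add_mono mult_left_mono) auto
  finally show ?case
    using expectation_random_subset_insert[OF insert.hyps assms(2,3)] by simp
qed

text \<open>Conditioning on the first component. \<open>A\<close> may exceed the support, so that
  the sum can run over the index set of the minimax inequality.\<close>

lemma prob_pair_pmf:
  assumes "finite A" "set_pmf M \<subseteq> A" "finite (set_pmf Q)"
  shows "measure_pmf.prob (pair_pmf M Q) B
    = (\<Sum>m\<in>A. pmf M m * measure_pmf.prob Q (Pair m -` B))"
proof -
  have "pair_pmf M Q = M \<bind> (\<lambda>m. map_pmf (Pair m) Q)"
    by (simp add: pair_pmf_def map_pmf_def)
  then have "measure_pmf.expectation (pair_pmf M Q) (indicator B)
      = measure_pmf.expectation (M \<bind> (\<lambda>m. map_pmf (Pair m) Q)) (indicator B)"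
    by (rule arg_cong)
  also have "\<dots> = (\<Sum>m\<in>A. pmf M m * measure_pmf.prob Q (Pair m -` B))"
    by (subst pmf_expectation_bind[where A = A]) (use assms in auto)
  finally show ?thesis by simp
qed

text \<open>Linearity of expectation; it turns removal probabilities summed over a prefix into an
  expected count, which the rank identity evaluates.\<close>

lemma expectation_card_Int:
  assumes "finite (set_pmf Q)" "finite A"
  shows "measure_pmf.expectation Q (\<lambda>R. real (card (A \<inter> T R)))
    = (\<Sum>x\<in>A. measure_pmf.prob Q {R. x \<in> T R})"
proof -
  have "real (card (A \<inter> T R)) = (\<Sum>x\<in>A. indicator {R. x \<in> T R} R)" for R
    using assms(2) by (simp add: indicator_def sum.If_cases Int_def)
  then show ?thesis
    using assms(1) by (simp add: Bochner_Integration.integral_sum integrable_measure_pmf_finite)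
qed

text \<open>Abel summation: decreasing nonnegative weights are nonnegative combinations of prefix
  indicators, so control of the prefix sums suffices.\<close>

lemma weighted_sum_nonpos:
  fixes a w :: "'a \<Rightarrow> real"
  assumes "distinct xs" "sorted_wrt (\<lambda>x y. w y \<le> w x) xs" "\<And>x. x \<in> set xs \<Longrightarrow> 0 \<le> w x"
    and "\<And>n. (\<Sum>x\<in>set (take n xs). a x) \<le> 0"
  shows "(\<Sum>x\<in>set xs. w x * a x) \<le> 0"
proof -
  \<comment> \<open>Strengthened for induction from the end of the list. The hypothesis is applied
    with the weight of the last element as \<open>c\<close>; lowering that factor afterwards is safe
    because the full sum is nonpositive.\<close>
  have "(\<Sum>x\<in>set xs. w x * a x) \<le> c * (\<Sum>x\<in>set xs. a x)"
    if "\<And>x. x \<in> set xs \<Longrightarrow> c \<le> w x" for c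
    using assms(1,2,4) that
  proof (induction xs arbitrary: c rule: rev_induct)
    case Nil
    then show ?case by simp
  next
    case (snoc x xs)
    have "(\<Sum>y\<in>set (take n xs). a y) \<le> 0" for n
      using snoc.prems(3)[of "min n (length xs)"] by (cases "n \<le> length xs") auto
    then have "(\<Sum>y\<in>set xs. w y * a y) \<le> w x * (\<Sum>y\<in>set xs. a y)"
      using snoc.prems(1,2) by (intro snoc.IH) (auto simp: sorted_wrt_append)
    then have "(\<Sum>y\<in>set (xs @ [x]). w y * a y) \<le> w x * (\<Sum>y\<in>set (xs @ [x]). a y)"
      using snoc.prems(1) by (simp add: algebra_simps)
    also have "\<dots> \<le> c * (\<Sum>y\<in>set (xs @ [x]). a y)"
      using snoc.prems(3)[of "Suc (length xs)"] snoc.prems(4)[of x]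
      by (intro mult_right_mono_neg) auto
    finally show ?case .
  qed
  from this[of 0] assms(3) show ?thesis by simp
qed

section \<open>Matroid rank and greedy completion\<close>

context matroid
begin

definition rank_of :: "'a set \<Rightarrow> nat" where
  "rank_of S = Max (card ` {B \<in> \<I>. B \<subseteq> S})"

lemma finite_indeps: "finite {B \<in> \<I>. B \<subseteq> S}"
  by (rule finite_subset[of _ "Pow E"]) (use indep_subset_ground finite_ground in auto)

lemma finite_indep: "A \<in> \<I> \<Longrightarrow> finite A"
  using indep_subset_ground finite_ground finite_subset by blast

lemma card_le_rank: "B \<in> \<I> \<Longrightarrow> B \<subseteq> S \<Longrightarrow> card B \<le> rank_of S"
  unfolding rank_of_def by (rule Max_ge) (use finite_indeps[of S] in auto)

lemma rank_attained: obtains B where "B \<in> \<I>" "B \<subseteq> S" "card B = rank_of S"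
proof -
  have "rank_of S \<in> card ` {B \<in> \<I>. B \<subseteq> S}"
    unfolding rank_of_def
    by (rule Max_in) (use finite_indeps[of S] indep_empty in auto)
  then show thesis using that by auto
qed

text \<open>Were \<open>A\<close> smaller than an independent subset of \<open>S\<close> attaining
  the rank, augmentation would enlarge it inside \<open>S\<close>.\<close>

lemma maximal_card_eq_rank:
  assumes "A \<in> \<I>" "A \<subseteq> S" "\<And>x. x \<in> S - A \<Longrightarrow> insert x A \<notin> \<I>"
  shows "card A = rank_of S"
proof (rule ccontr)
  assume "card A \<noteq> rank_of S"
  then have "card A < rank_of S"
    using card_le_rank[OF assms(1,2)] by simp
  moreover obtain B where B: "B \<in> \<I>" "B \<subseteq> S" "card B = rank_of S"
    by (rule rank_attained)
  ultimately obtain b where "b \<in> B - A" "insert b A \<in> \<I>"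
    using augmentation[OF assms(1) B(1)] by auto
  with assms(3)[of b] B(2) show False by auto
qed

lemma rank_indep: "A \<in> \<I> \<Longrightarrow> rank_of A = card A"
  by (rule maximal_card_eq_rank[symmetric]) auto

lemma indep_extends:
  assumes "A \<in> \<I>" "A \<subseteq> S"
  obtains B where "B \<in> \<I>" "A \<subseteq> B" "B \<subseteq> S" "card B = rank_of S"
proof -
  obtain B where B: "B \<in> \<I>" "A \<subseteq> B" "B \<subseteq> S"
    "\<And>C. C \<in> \<I> \<Longrightarrow> C \<subseteq> S \<Longrightarrow> B \<subseteq> C \<Longrightarrow> B = C"
    using finite_has_maximal2[OF finite_indeps[of S], of A] assms by auto
  have "insert x B \<notin> \<I>" if "x \<in> S - B" for x
    using B(3) B(4)[of "insert x B"] that by auto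
  then show thesis
    using that[OF B(1-3)] maximal_card_eq_rank[OF B(1,3)] by blast
qed

text \<open>Extend a basis \<open>K\<close> of \<open>A \<inter> B\<close> to a basis
  \<open>J\<close> of \<open>A \<union> B\<close>. The traces of \<open>J\<close> on
  \<open>A\<close> and on \<open>B\<close> are independent, and inclusion-exclusion counts
  \<open>J\<close> once and its trace on \<open>A \<inter> B\<close>, which contains
  \<open>K\<close>, once more.\<close>

lemma rank_submodular: "rank_of (A \<union> B) + rank_of (A \<inter> B) \<le> rank_of A + rank_of B"
proof -
  obtain K where K: "K \<in> \<I>" "K \<subseteq> A \<inter> B" "card K = rank_of (A \<inter> B)"
    using rank_attained by blast
  then obtain J where J: "J \<in> \<I>" "K \<subseteq> J" "J \<subseteq> A \<union> B" "card J = rank_of (A \<union> B)"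
    using indep_extends[of K "A \<union> B"] by blast
  have fin: "finite J" using J(1) finite_indep by blast
  have "J \<inter> A \<in> \<I>" "J \<inter> B \<in> \<I>" using indep_mono[OF J(1)] by auto
  then have "card (J \<inter> A) + card (J \<inter> B) \<le> rank_of A + rank_of B"
    by (intro add_mono card_le_rank) auto
  moreover have "card (J \<inter> A) + card (J \<inter> B) = card J + card (J \<inter> (A \<inter> B))"
  proof -
    have "(J \<inter> A) \<union> (J \<inter> B) = J" "(J \<inter> A) \<inter> (J \<inter> B) = J \<inter> (A \<inter> B)" using J(3) by auto
    then show ?thesis using card_Un_Int[of "J \<inter> A" "J \<inter> B"] fin by simp
  qed
  moreover have "card K \<le> card (J \<inter> (A \<inter> B))"
    using K(2) J(2) fin by (intro card_mono) auto
  ultimately show ?thesis using K(3) J(4) by linarith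
qed

text \<open>\<open>T\<close> collects the elements rejected when \<open>xs\<close> is scanned in
  order. The equation says that the part of \<open>B \<union> set (take n xs)\<close> that is kept
  has full rank there, with one \<open>T\<close> serving all prefixes; it is written additively to
  avoid truncated subtraction.\<close>

lemma greedy_completion:
  assumes "B \<in> \<I>" "distinct xs" "set xs \<inter> B = {}"
  shows "\<exists>T \<subseteq> set xs. (B \<union> set xs) - T \<in> \<I> \<and>
    (\<forall>n. card (set (take n xs) \<inter> T) + rank_of (B \<union> set (take n xs))
        = card (set (take n xs)) + card B)"
  using assms(2,3)
proof (induction xs rule: rev_induct)
  case Nil
  then show ?case using assms(1) rank_indep by simp
next
  case (snoc x xs)
  then have "distinct xs" "set xs \<inter> B = {}" by auto
  from snoc.IH[OF this] obtain T where T: "T \<subseteq> set xs" "(B \<union> set xs) - T \<in> \<I>"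
    "\<And>n. card (set (take n xs) \<inter> T) + rank_of (B \<union> set (take n xs))
        = card (set (take n xs)) + card B"
    by blast
  define C where "C = (B \<union> set xs) - T"
  define T' where "T' = (if insert x C \<in> \<I> then T else insert x T)"
  have x: "x \<notin> set xs" "x \<notin> B" using snoc.prems by auto
  have fin: "finite B" using assms(1) finite_indep by blast
  have C': "(B \<union> set (xs @ [x])) - T' = (if insert x C \<in> \<I> then insert x C else C)"
    using x T(1) by (auto simp: T'_def C_def)
  have indep: "(B \<union> set (xs @ [x])) - T' \<in> \<I>"
    using C' T(2) C_def by simp
  have T'_sub: "T' \<subseteq> set (xs @ [x])"
    using T(1) by (auto simp: T'_def)
  \<comment> \<open>By the equation for the whole of \<open>xs\<close>, \<open>C\<close> already has
    the size of the rank, so a larger independent set is impossible.\<close>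
  have max: "insert y C \<notin> \<I>" if y: "y \<in> (B \<union> set xs) - C" for y
  proof
    assume ind: "insert y C \<in> \<I>"
    have "card C = card B + card (set xs) - card T"
      unfolding C_def using T(1) fin snoc.prems
      by (subst card_Diff_subset) (auto simp: card_Un_disjoint Int_commute intro: finite_subset)
    moreover have "card T \<le> card (set xs)" using T(1) by (simp add: card_mono)
    moreover have "card T + rank_of (B \<union> set xs) = card (set xs) + card B"
      using T(3)[of "length xs"] T(1) by (simp add: Int_absorb1)
    moreover have "card (insert y C) \<le> rank_of (B \<union> set xs)"
      using ind y by (intro card_le_rank) (auto simp: C_def)
    moreover have "card (insert y C) = Suc (card C)"
      using y T(2) finite_indep by (auto simp: C_def)
    ultimately show False by linarith
  qed
  \<comment> \<open>Dependence passes to supersets, so elements rejected earlier stay rejected after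
    \<open>x\<close> has been processed.\<close>
  have "C \<subseteq> (B \<union> set (xs @ [x])) - T'"
    unfolding C' by auto
  then have "insert y ((B \<union> set (xs @ [x])) - T') \<notin> \<I>" if "insert y C \<notin> \<I>" for y
    using that indep_mono[of _ "insert y C"] by blast
  moreover have "insert y C \<notin> \<I>" if "y \<in> T'" for y
  proof (cases "y \<in> T")
    case True
    then show ?thesis using max[of y] T(1) by (auto simp: C_def)
  next
    case False
    then show ?thesis using that by (auto simp: T'_def split: if_splits)
  qed
  ultimately have "card ((B \<union> set (xs @ [x])) - T') = rank_of (B \<union> set (xs @ [x]))"
    using indep by (intro maximal_card_eq_rank) blast+
  moreover have "card ((B \<union> set (xs @ [x])) - T') + card T' = card B + card (set (xs @ [x]))"
  proof -
    have "T' \<subseteq> B \<union> set (xs @ [x])" "finite (B \<union> set (xs @ [x]))"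
      using T'_sub fin by auto
    then have "card ((B \<union> set (xs @ [x])) - T') + card T' = card (B \<union> set (xs @ [x]))"
      by (simp add: card_Diff_subset card_mono finite_subset del: set_append)
    also have "\<dots> = card B + card (set (xs @ [x]))"
      using fin snoc.prems by (intro card_Un_disjoint) auto
    finally show ?thesis .
  qed
  ultimately have full: "card T' + rank_of (B \<union> set (xs @ [x])) = card (set (xs @ [x])) + card B"
    by linarith
  have "card (set (take n (xs @ [x])) \<inter> T') + rank_of (B \<union> set (take n (xs @ [x])))
      = card (set (take n (xs @ [x]))) + card B" for n
  proof (cases "n \<le> length xs")
    case True
    then have "x \<notin> set (take n xs)" using x in_set_takeD by fast
    then have "set (take n xs) \<inter> T' = set (take n xs) \<inter> T" by (auto simp: T'_def)
    then show ?thesis using T(3)[of n] True by simp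
  next
    case False
    then have "take n (xs @ [x]) = xs @ [x]" by simp
    moreover have "set (xs @ [x]) \<inter> T' = T'" using T'_sub by blast
    ultimately show ?thesis using full by simp
  qed
  then show ?case using indep T'_sub by blast
qed

text \<open>For each prefix \<open>A\<close> of \<open>X - Y\<close> in the order of decreasing weight, the greedily removed set \<open>T R\<close>
  meets \<open>A\<close> in \<open>card A + card (X \<inter> Y) - (rank_of ((X \<inter> Y) \<union> R \<union> A) - card R)\<close> elements, and the
  subtracted term is submodular in \<open>R\<close>.\<close>

lemma weighted_exchange:
  fixes w :: "'a \<Rightarrow> real"
  assumes X: "X \<in> \<I>" and Y: "Y \<in> \<I>" and p: "0 \<le> p" "p \<le> 1"
    and w: "\<And>x. x \<in> X - Y \<Longrightarrow> 0 \<le> w x"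
  shows "\<exists>T. (\<forall>R \<subseteq> Y - X. T R \<subseteq> X - Y \<and> (X \<union> R) - T R \<in> \<I>) \<and>
    (\<Sum>x\<in>X - Y. w x * measure_pmf.prob (random_subset (Y - X) p) {R. x \<in> T R}) \<le> p * sum w (X - Y)"
proof -
  define V where "V = Y - X"
  define Z where "Z = X \<inter> Y"
  define Q where "Q = random_subset V p"
  have fin: "finite X" "finite Y" "finite V" "finite Z"
    using X Y finite_indep by (auto simp: V_def Z_def)
  have finQ: "finite (set_pmf Q)"
    unfolding Q_def using fin(3) by (rule finite_set_random_subset)
  have subQ: "set_pmf Q \<subseteq> Pow V"
    unfolding Q_def by (rule set_random_subset)
  obtain ys where ys: "set ys = X - Y" "distinct ys"
    using finite_distinct_list fin(1) by (metis finite_Diff)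
  define xs where "xs = sort_key (\<lambda>x. - w x) ys"
  have xs: "set xs = X - Y" "distinct xs"
    using ys by (auto simp: xs_def)
  have sorted: "sorted_wrt (\<lambda>x y. w y \<le> w x) xs"
    using sorted_sort_key[of "\<lambda>x. - w x" ys] by (simp add: sorted_map xs_def)
  \<comment> \<open>Seeding the greedy scan with \<open>Z \<union> R\<close>, independent as a
    subset of \<open>Y\<close>, ensures that only elements of \<open>X - Y\<close> are ever
    discarded.\<close>
  have "\<exists>T \<subseteq> X - Y. (X \<union> R) - T \<in> \<I> \<and>
    (\<forall>n. card (set (take n xs) \<inter> T) + rank_of (Z \<union> R \<union> set (take n xs))
        = card (set (take n xs)) + card Z + card R)" if R: "R \<subseteq> V" for R
  proof -
    have "Z \<union> R \<in> \<I>" by (rule indep_mono[OF Y]) (use R in \<open>auto simp: Z_def V_def\<close>)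
    moreover have "set xs \<inter> (Z \<union> R) = {}" using R xs(1) by (auto simp: Z_def V_def)
    moreover have "Z \<union> R \<union> set xs = X \<union> R" using xs(1) R by (auto simp: Z_def V_def)
    moreover have "card (Z \<union> R) = card Z + card R"
      using R fin(3,4) finite_subset[of R V] by (intro card_Un_disjoint) (auto simp: Z_def V_def)
    ultimately show ?thesis
      using greedy_completion[of "Z \<union> R" xs, OF _ xs(2)] xs(1) by (simp only: add.assoc)
  qed
  then have "\<forall>R\<in>Pow V. \<exists>T. T \<subseteq> X - Y \<and> (X \<union> R) - T \<in> \<I> \<and>
    (\<forall>n. card (set (take n xs) \<inter> T) + rank_of (Z \<union> R \<union> set (take n xs))
        = card (set (take n xs)) + card Z + card R)"
    by blast
  then obtain T where T: "\<forall>R\<in>Pow V. T R \<subseteq> X - Y \<and> (X \<union> R) - T R \<in> \<I> \<and>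
    (\<forall>n. card (set (take n xs) \<inter> T R) + rank_of (Z \<union> R \<union> set (take n xs))
        = card (set (take n xs)) + card Z + card R)"
    by (rule bchoice[THEN exE])
  then have T_card: "card (set (take n xs) \<inter> T R) + rank_of (Z \<union> R \<union> set (take n xs))
      = card (set (take n xs)) + card Z + card R" if "R \<subseteq> V" for R n
    using that by simp
  have prefix: "(\<Sum>x\<in>set (take n xs). measure_pmf.prob Q {R. x \<in> T R} - p) \<le> 0" for n
  proof -
    define A where "A = set (take n xs)"
    \<comment> \<open>For \<open>R \<subseteq> V\<close> this is the number of elements of
      \<open>Z \<union> A\<close> that survive the removal of \<open>T R\<close>. Subtracting the
      modular term \<open>card R\<close> preserves submodularity.\<close>
    define f where "f = (\<lambda>R. real (rank_of (Z \<union> R \<union> A)) - real (card R))"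
    have A: "A \<subseteq> X - Y" using set_take_subset xs(1) unfolding A_def by metis
    have "f (R \<union> S) + f (R \<inter> S) \<le> f R + f S" if "R \<subseteq> V" "S \<subseteq> V" for R S
    proof -
      have "(Z \<union> R \<union> A) \<union> (Z \<union> S \<union> A) = Z \<union> (R \<union> S) \<union> A"
        "(Z \<union> R \<union> A) \<inter> (Z \<union> S \<union> A) = Z \<union> (R \<inter> S) \<union> A" by auto
      moreover have "card R + card S = card (R \<union> S) + card (R \<inter> S)"
        using that fin(3) by (intro card_Un_Int) (auto intro: finite_subset)
      ultimately show ?thesis
        using rank_submodular[of "Z \<union> R \<union> A" "Z \<union> S \<union> A"] by (simp add: f_def)
    qed
    then have Ef: "(1 - p) * f {} + p * f V \<le> measure_pmf.expectation Q f"
      unfolding Q_def using fin(3) p by (intro submodular_expectation_ge) auto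
    \<comment> \<open>Endpoint values: for empty \<open>R\<close> nothing of
      \<open>Z \<union> A\<close> is lost, as it lies in \<open>X\<close>; for \<open>R = V\<close>
      the set spans at least the rank of \<open>Y\<close>, so \<open>f V\<close> is at least
      \<open>card Z\<close>. Mixing the two with weights \<open>1 - p\<close> and \<open>p\<close>
      leaves an expected loss of at most \<open>p * card A\<close>.\<close>
    have "Z \<union> A \<in> \<I>" by (rule indep_mono[OF X]) (use A in \<open>auto simp: Z_def\<close>)
    moreover have "card (Z \<union> A) = card Z + card A"
      using A fin(1,4) finite_subset[of A X] by (intro card_Un_disjoint) (auto simp: Z_def)
    ultimately have f0: "f {} = card Z + card A"
      by (simp add: f_def rank_indep)
    have "card Y \<le> rank_of (Z \<union> V \<union> A)"
      using Y by (intro card_le_rank) (auto simp: Z_def V_def)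
    moreover have "card Y = card Z + card V"
    proof -
      have "Y = Z \<union> V" "Z \<inter> V = {}" by (auto simp: Z_def V_def)
      then show ?thesis using card_Un_disjoint fin(3,4) by metis
    qed
    ultimately have fV: "f V \<ge> card Z" by (simp add: f_def)
    have "(\<Sum>x\<in>A. measure_pmf.prob Q {R. x \<in> T R})
        = measure_pmf.expectation Q (\<lambda>R. real (card (A \<inter> T R)))"
      by (rule expectation_card_Int[OF finQ, symmetric]) (simp add: A_def)
    also have "\<dots> = measure_pmf.expectation Q (\<lambda>R. real (card A + card Z) - f R)"
    proof (rule integral_cong_AE)
      show "AE R in measure_pmf Q. real (card (A \<inter> T R)) = real (card A + card Z) - f R"
        unfolding AE_measure_pmf_iff
      proof
        fix R assume "R \<in> set_pmf Q"
        then have "R \<subseteq> V" using subQ by auto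
        from T_card[OF this, of n] show "real (card (A \<inter> T R)) = real (card A + card Z) - f R"
          by (simp add: f_def A_def)
      qed
    qed auto
    also have "\<dots> = real (card A + card Z) - measure_pmf.expectation Q f"
      by (subst Bochner_Integration.integral_diff) (auto intro: integrable_measure_pmf_finite finQ)
    also have "\<dots> \<le> real (card A + card Z) - ((1 - p) * f {} + p * f V)"
      using Ef by simp
    also have "\<dots> \<le> real (card A + card Z) - ((1 - p) * f {} + p * card Z)"
      using mult_left_mono[OF fV p(1)] by simp
    also have "\<dots> = p * card A" by (simp add: f0 algebra_simps)
    finally show ?thesis by (simp add: sum_subtractf A_def mult.commute)
  qed
  have "(\<Sum>x\<in>set xs. w x * (measure_pmf.prob Q {R. x \<in> T R} - p)) \<le> 0"
    using weighted_sum_nonpos[OF xs(2) sorted _ prefix] w xs(1) by blast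
  then have "(\<Sum>x\<in>X - Y. w x * measure_pmf.prob Q {R. x \<in> T R}) \<le> p * sum w (X - Y)"
    by (simp add: xs(1) algebra_simps sum_subtractf flip: sum_distrib_left)
  then show ?thesis
    using T unfolding Q_def V_def by blast
qed

end

section \<open>Intersections of matroids and the random exchange map\<close>

text \<open>Remove everything that some matroid wants removed: independence is downward closed, so
  each matroid tolerates the removals of the others, and the union bound costs the factor
  \<open>k\<close>.\<close>

lemma intersection_weighted_exchange:
  fixes w :: "'a \<Rightarrow> real" and k :: nat
  assumes "\<And>i. i \<in> {1..k} \<Longrightarrow> matroid E (\<I> i)"
    and X: "X \<in> (\<Inter>i\<in>{1..k}. \<I> i)" and Y: "Y \<in> (\<Inter>i\<in>{1..k}. \<I> i)" and p: "0 \<le> p" "p \<le> 1"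
    and w: "\<And>x. x \<in> X - Y \<Longrightarrow> 0 \<le> w x"
  shows "\<exists>T. (\<forall>R \<subseteq> Y - X. T R \<subseteq> X - Y \<and> (X \<union> R) - T R \<in> (\<Inter>i\<in>{1..k}. \<I> i)) \<and>
    (\<forall>R. \<not> R \<subseteq> Y - X \<longrightarrow> T R = {}) \<and>
    (\<Sum>x\<in>X - Y. w x * (measure_pmf.prob (random_subset (Y - X) p) {R. x \<in> T R} - p * k)) \<le> 0"
proof -
  let ?P = "measure_pmf.prob (random_subset (Y - X) p)"
  have "\<forall>i\<in>{1..k}. \<exists>T. (\<forall>R \<subseteq> Y - X. T R \<subseteq> X - Y \<and> (X \<union> R) - T R \<in> \<I> i) \<and>
      (\<Sum>x\<in>X - Y. w x * ?P {R. x \<in> T R}) \<le> p * sum w (X - Y)"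
    using assms by (intro ballI matroid.weighted_exchange) auto
  then obtain T where T: "\<forall>i\<in>{1..k}. (\<forall>R \<subseteq> Y - X. T i R \<subseteq> X - Y \<and> (X \<union> R) - T i R \<in> \<I> i) \<and>
      (\<Sum>x\<in>X - Y. w x * ?P {R. x \<in> T i R}) \<le> p * sum w (X - Y)"
    by (rule bchoice[THEN exE])
  \<comment> \<open>The default \<open>{}\<close> at irrelevant arguments leaves only finitely many
    competing maps, as the minimax lemma requires.\<close>
  define U where "U = (\<lambda>R. if R \<subseteq> Y - X then \<Union>i\<in>{1..k}. T i R else {})"
  show ?thesis
  proof (intro exI[of _ U] conjI allI impI)
    show "U R \<subseteq> X - Y" if "R \<subseteq> Y - X" for R
      using T that by (auto simp: U_def)
    show "(X \<union> R) - U R \<in> (\<Inter>i\<in>{1..k}. \<I> i)" if R: "R \<subseteq> Y - X" for R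
    proof
      fix i assume i: "i \<in> {1..k}"
      show "(X \<union> R) - U R \<in> \<I> i"
      proof (rule matroid.indep_mono[OF assms(1)[OF i]])
        show "(X \<union> R) - T i R \<in> \<I> i" using T R i by blast
        show "(X \<union> R) - U R \<subseteq> (X \<union> R) - T i R" using R i by (auto simp: U_def)
      qed
    qed
    show "U R = {}" if "\<not> R \<subseteq> Y - X" for R
      using that by (simp add: U_def)
    have "?P {R. x \<in> U R} \<le> (\<Sum>i\<in>{1..k}. ?P {R. x \<in> T i R})" for x
    proof -
      have "?P {R. x \<in> U R} \<le> ?P (\<Union>i\<in>{1..k}. {R. x \<in> T i R})"
        by (intro measure_pmf.finite_measure_mono) (auto simp: U_def split: if_splits)
      also have "\<dots> \<le> (\<Sum>i\<in>{1..k}. ?P {R. x \<in> T i R})"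
        by (intro measure_pmf.finite_measure_subadditive_finite) auto
      finally show ?thesis .
    qed
    then have "(\<Sum>x\<in>X - Y. w x * ?P {R. x \<in> U R})
        \<le> (\<Sum>x\<in>X - Y. w x * (\<Sum>i\<in>{1..k}. ?P {R. x \<in> T i R}))"
      using w by (intro sum_mono mult_left_mono) auto
    also have "\<dots> = (\<Sum>i\<in>{1..k}. \<Sum>x\<in>X - Y. w x * ?P {R. x \<in> T i R})"
      by (simp only: sum_distrib_left) (rule sum.swap)
    also have "\<dots> \<le> (\<Sum>i\<in>{1..k}. p * sum w (X - Y))"
      using T by (intro sum_mono) auto
    also have "\<dots> = (\<Sum>x\<in>X - Y. w x * (p * k))"
      by (simp flip: sum_distrib_right)
    finally show "(\<Sum>x\<in>X - Y. w x * (?P {R. x \<in> U R} - p * k)) \<le> 0"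
      by (simp add: right_diff_distrib sum_subtractf)
  qed
qed

theorem lemma4p5:
  fixes E :: "'a set" and D :: "'a set set" and p :: real and k :: nat
  assumes "finite E" and "0 < p" and "p < 1" and "k \<ge> 1"
    and "k_intersection_system k E D"
  shows "admits_uniform_exchange_map p p (p * real k) D"
  unfolding admits_uniform_exchange_map_def
proof (intro ballI)
  fix X Y assume XY: "X \<in> D" "Y \<in> D"
  obtain \<I> where mat: "\<And>i. i \<in> {1..k} \<Longrightarrow> matroid E (\<I> i)" and D: "D = (\<Inter>i\<in>{1..k}. \<I> i)"
    using assms(5) unfolding k_intersection_system_def by blast
  have "X \<subseteq> E" "Y \<subseteq> E"
    using XY assms(4) matroid.indep_subset_ground[OF mat[of 1]] unfolding D by auto
  then have fin: "finite (X - Y)" "finite (Y - X)"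
    using assms(1) finite_subset by (metis finite_Diff)+
  define Q where "Q = random_subset (Y - X) p"
  define F where "F = {T. (\<forall>R \<subseteq> Y - X. T R \<subseteq> X - Y \<and> (X \<union> R) - T R \<in> D) \<and>
    (\<forall>R. \<not> R \<subseteq> Y - X \<longrightarrow> T R = {})}"
  have "finite F"
    by (rule finite_subset[OF _ finite_set_of_finite_funs[of "Pow (Y - X)" "Pow (X - Y)" "{}"]])
      (use fin in \<open>auto simp: F_def\<close>)
  \<comment> \<open>The payoff of a map \<open>T\<close> at \<open>x\<close> is the excess of its
    removal probability over \<open>p * k\<close>. Minimax turns a good map for each weighting into
    one mixture \<open>N\<close> that is good at every \<open>x\<close> simultaneously.\<close>
  moreover have "\<exists>T\<in>F. (\<Sum>x\<in>X - Y. w x * (measure_pmf.prob Q {R. x \<in> T R} - p * k)) \<le> 0"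
    if "\<And>x. x \<in> X - Y \<Longrightarrow> 0 \<le> w x" for w
    using intersection_weighted_exchange[OF mat XY[unfolded D], of p w] assms(2,3) that
    unfolding F_def Q_def D by (simp add: Bex_def)
  ultimately obtain N where N: "set_pmf N \<subseteq> F"
    "\<And>x. x \<in> X - Y \<Longrightarrow> (\<Sum>T\<in>F. pmf N T * (measure_pmf.prob Q {R. x \<in> T R} - p * k)) \<le> 0"
    using ville_minimax_pmf[of F "X - Y" "\<lambda>T x. measure_pmf.prob Q {R. x \<in> T R} - p * k"] fin(1)
    by blast
  have finQ: "finite (set_pmf Q)"
    using fin finite_set_random_subset by (simp add: Q_def)
  \<comment> \<open>Only the removals are randomised. All sampled elements are inserted, so each is
    present with probability exactly \<open>p\<close>.\<close>
  define M where "M = map_pmf (\<lambda>T. (id :: 'a set \<Rightarrow> 'a set, T)) N"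
  have pair: "pair_pmf M Q = map_pmf (\<lambda>(T, R). ((id, T), R)) (pair_pmf N Q)"
    by (simp add: M_def pair_map_pmf1 apfst_def map_prod_def)
  have "exchange_map D X Y M"
    using N(1) by (auto simp: exchange_map_def exchange_pair_def M_def F_def)
  moreover have "p \<le> measure_pmf.prob (pair_pmf M Q) {((S, T), R). y \<in> S R}" if "y \<in> Y - X" for y
  proof -
    have "measure_pmf.prob (pair_pmf M Q) {((S, T), R). y \<in> S R}
        = measure_pmf.prob (map_pmf snd (pair_pmf N Q)) {R. y \<in> R}"
      unfolding pair measure_map_pmf
      by (intro arg_cong2[where f = measure_pmf.prob]) auto
    also have "\<dots> = p"
      unfolding map_snd_pair_pmf Q_def
      using that fin assms(2,3) by (intro prob_random_subset_member) auto
    finally show ?thesis by simp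
  qed
  moreover have "measure_pmf.prob (pair_pmf M Q) {((S, T), R). x \<in> T R} \<le> p * k" if "x \<in> X - Y" for x
  proof -
    have "measure_pmf.prob (pair_pmf M Q) {((S, T), R). x \<in> T R}
        = measure_pmf.prob (pair_pmf N Q) {(T, R). x \<in> T R}"
      unfolding pair measure_map_pmf
      by (intro arg_cong2[where f = measure_pmf.prob]) auto
    also have "\<dots> = (\<Sum>T\<in>F. pmf N T * measure_pmf.prob Q {R. x \<in> T R})"
      using prob_pair_pmf[OF \<open>finite F\<close> N(1) finQ] by (simp add: vimage_def)
    also have "\<dots> \<le> (\<Sum>T\<in>F. pmf N T) * (p * k)"
      using N(2)[OF that] by (simp add: right_diff_distrib sum_subtractf sum_distrib_right)
    also have "(\<Sum>T\<in>F. pmf N T) = 1"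
      using \<open>finite F\<close> N(1) by (rule sum_pmf_eq_1)
    finally show ?thesis by simp
  qed
  ultimately show "\<exists>M. uniform_exchange_map p p (p * real k) D X Y M"
    unfolding uniform_exchange_map_def Q_def by blast
qed

end
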